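(* Let $p=q\in(0,1)$ be a constant, let $\zeta\ge 40$ be a constant, and for each $n$ let $\lambda=\lambda_n=\frac{1}{\zeta n}$. Let $c=1-\frac12\left(\sqrt{\zeta^2+4\zeta}-\zeta\right)\in(0,1)$. Let $\mathcal{P}_\lambda$ be the planted matching model and $\mathcal{Q}=G(n,q)$. Define the threshold test $\varphi_n:\{0,1\}^{\binom{[n]}{2}}\to\{0,1\}$ by $$\varphi_n(A)=\mathbf{1}\left\{\frac{\check{K_2}(A)}{\sqrt{\binom n2 p(1-p)}}\ \ge\ \frac{c}{2\sqrt2}\sqrt{\frac{1-p}{p}}\right\},\qquad \check{K_2}(A)=\sum_{\{i,j\}\in\binom{[n]}{2}}(A_{ij}-q).$$ Then, as $n\to\infty$, $$\mathbb{P}_{A\sim\mathcal{P}_\lambda}[\varphi_n(A)=0]+\mathbb{P}_{A\sim\mathcal{Q}}[\varphi_n(A)=1]\ \longrightarrow\ 2\,\Phi\left(-\frac{c}{2\sqrt2}\sqrt{\frac{1-p}{p}}\right).$$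
   Context: A matching in a graph is a set of pairwise non-adjacent (vertex-disjoint) edges; the empty set is a matching. For a simple graph $G$ and $\lambda>0$, the monomer-dimer Gibbs measure on matchings $M$ of $G$ is $\mu_{\lambda,G}(M)=\lambda^{|M|}/Z_G(\lambda)$ with $Z_G(\lambda)=\sum_{M\subset G}\lambda^{|M|}$ (sum over all matchings $M$ in $G$, where $|M|$ is the number of edges). Write $\mu_\lambda=\mu_{\lambda,K_n}$, where $K_n$ is the complete graph on $[n]=\{1,\dots,n\}$. The planted matching model $\mathcal{P}_\lambda$ (with parameters $n,p,\lambda$) is the law of the adjacency matrix $A$ of a random graph on $[n]$ generated as follows: sample $M\sim\mu_\lambda$; conditionally on $M$, set $A_{ij}=1$ if $\{i,j\}\in M$, and let $A_{ij}\sim\mathrm{Bernoulli}(p)$ independently for $\{i,j\}\notin M$. The null model $\mathcal{Q}=G(n,q)$ is the Erdős–Rényi random graph on $[n]$, with all edges independent $\mathrm{Bernoulli}(q)$. Graphs are identified with elements of $\{0,1\}^{\binom{[n]}{2}}$. $\Phi$ denotes the standard Gaussian cumulative distribution function. *)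

theory Defs
  imports "HOL-Probability.Probability" "HOL-Library.Ramsey"
begin

text \<open>
  The vertex set is \<open>{1..n}\<close>, and the edge set of a simple graph is a set of two-element sets
  of vertices. A random graph on \<open>{1..n}\<close> is given by its adjacency indicator
  \<open>A :: nat set \<Rightarrow> bool\<close>, where \<open>A {i, j}\<close> stands for \<open>A\<^sub>i\<^sub>j = 1\<close>; the laws below
  are supported on indicators that vanish outside the edge set of the complete graph.
\<close>

definition complete_edges :: "nat \<Rightarrow> nat set set" where
  "complete_edges n = nsets {1..n} 2"

definition matchings :: "'a set set \<Rightarrow> 'a set set set" where
  "matchings E = {M. M \<subseteq> E \<and> pairwise disjnt M}"

definition matching_partition :: "'a set set \<Rightarrow> real \<Rightarrow> real" where
  "matching_partition E lam = (\<Sum>M\<in>matchings E. lam ^ card M)"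

text \<open>
  The constant \<open>embed_pmf\<close> is meaningful only for mass functions; the lemma \<open>pmf_monomer_dimer\<close>
  below shows that this is the case for finite \<open>E\<close> and \<open>lam \<ge> 0\<close>.
\<close>

definition monomer_dimer :: "'a set set \<Rightarrow> real \<Rightarrow> 'a set set pmf" where
  "monomer_dimer E lam = embed_pmf
     (\<lambda>M. if M \<in> matchings E then lam ^ card M / matching_partition E lam else 0)"

definition planted_matching :: "nat \<Rightarrow> real \<Rightarrow> real \<Rightarrow> (nat set \<Rightarrow> bool) pmf" where
  "planted_matching n p lam =
     bind_pmf (monomer_dimer (complete_edges n) lam)
       (\<lambda>M. Pi_pmf (complete_edges n) False
          (\<lambda>e. if e \<in> M then return_pmf True else bernoulli_pmf p))"

definition erdos_renyi :: "nat \<Rightarrow> real \<Rightarrow> (nat set \<Rightarrow> bool) pmf" where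
  "erdos_renyi n q = Pi_pmf (complete_edges n) False (\<lambda>_. bernoulli_pmf q)"

definition centered_edge_count :: "nat \<Rightarrow> real \<Rightarrow> (nat set \<Rightarrow> bool) \<Rightarrow> real" where
  "centered_edge_count n q A = (\<Sum>e\<in>complete_edges n. (of_bool (A e) - q))"

definition threshold_test :: "real \<Rightarrow> real \<Rightarrow> real \<Rightarrow> nat \<Rightarrow> (nat set \<Rightarrow> bool) \<Rightarrow> nat" where
  "threshold_test p q c n A = of_bool
     (centered_edge_count n q A / sqrt (real (n choose 2) * p * (1 - p))
        \<ge> c / (2 * sqrt 2) * sqrt ((1 - p) / p))"

definition std_normal_cdf :: "real \<Rightarrow> real" where
  "std_normal_cdf = cdf std_normal_distribution"

lemma finite_matchings: "finite E \<Longrightarrow> finite (matchings E)"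
  by (simp add: matchings_def)

lemma matching_partition_pos:
  assumes "finite E" "lam \<ge> 0"
  shows "matching_partition E lam > 0"
proof -
  have "{} \<in> matchings E"
    by (simp add: matchings_def)
  then show ?thesis
    unfolding matching_partition_def
    using assms by (intro sum_pos2[where i = "{}"]) (auto simp: finite_matchings)
qed

lemma pmf_monomer_dimer:
  assumes "finite E" "lam \<ge> 0"
  shows "pmf (monomer_dimer E lam) M =
    (if M \<in> matchings E then lam ^ card M / matching_partition E lam else 0)"
proof -
  define f where
    "f = (\<lambda>M. if M \<in> matchings E then lam ^ card M / matching_partition E lam else 0)"
  have pos: "matching_partition E lam > 0"
    using assms by (rule matching_partition_pos)
  have nonneg: "f N \<ge> 0" for N
    using pos assms(2) by (simp add: f_def)
  have "(\<integral>\<^sup>+N. ennreal (f N) \<partial>count_space UNIV) = (\<Sum>N\<in>matchings E. ennreal (f N))"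
    using assms(1) by (intro nn_integral_count_space') (auto simp: f_def finite_matchings)
  also have "\<dots> = ennreal (\<Sum>N\<in>matchings E. f N)"
    using nonneg by (simp add: sum_ennreal)
  also have "(\<Sum>N\<in>matchings E. f N) = matching_partition E lam / matching_partition E lam"
    by (simp add: f_def matching_partition_def flip: sum_divide_distrib)
  also have "\<dots> = 1"
    using pos by simp
  finally have "(\<integral>\<^sup>+N. ennreal (f N) \<partial>count_space UNIV) = 1"
    by simp
  with nonneg have "pmf (embed_pmf f) M = f M"
    by (rule pmf_embed_pmf)
  then show ?thesis
    by (simp add: monomer_dimer_def f_def)
qed

lemma matching_constant_bounds:
  fixes \<zeta> :: real
  assumes "\<zeta> > 0"
  shows "1 - 1 / 2 * (sqrt (\<zeta>\<^sup>2 + 4 * \<zeta>) - \<zeta>) \<in> {0<..<1}"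
proof -
  have "sqrt (\<zeta>\<^sup>2 + 4 * \<zeta>) < \<zeta> + 2"
    using assms by (intro real_less_lsqrt) (auto simp: power2_eq_square algebra_simps)
  moreover have "\<zeta> < sqrt (\<zeta>\<^sup>2 + 4 * \<zeta>)"
    using assms by (intro real_less_rsqrt) auto
  ultimately show ?thesis
    by simp
qed

end

theory Submission
  imports Defs "HOL-Real_Asymp.Real_Asymp"
begin

text \<open>
  Given the planted matching \<open>M\<close>, the characteristic function of the centered edge count is explicit
  and depends on \<open>M\<close> only through \<open>|M|\<close>: the planted edges contribute the phase
  \<open>iexp (u * (1 - p) * |M|)\<close> and the others a power of the characteristic function of a centered
  Bernoulli variable. Removing an edge from a matching gives
  \<open>E[K f(K)] = E[lam (n - 2K choose 2) f(K + 1)]\<close> for the size \<open>K\<close> of \<open>M\<close>, from which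
  \<open>K / n\<close> tends to \<open>c / 2\<close> in mean square, where \<open>\<zeta> c = (1 - c)\<^sup>2\<close>. So the normalized edge count tends
  to a standard normal variable under the null model and to one shifted by twice the threshold under
  the planted model, and both error probabilities tend to the same normal tail.
\<close>

section \<open>Weak convergence to the normal law via characteristic functions\<close>

lemma char_distr_measure_pmf:
  fixes X :: "'a \<Rightarrow> real"
  shows "char (distr (measure_pmf P) borel X) t = measure_pmf.expectation P (\<lambda>x. iexp (t * X x))"
  unfolding char_def by (subst integral_distr) auto

lemma emeasure_std_normal_singleton: "emeasure std_normal_distribution {a} = 0"
proof -
  have "AE x in lborel. x \<noteq> a"
    by (rule AE_lborel_singleton)
  then have "AE x in lborel. x \<in> {a} \<longrightarrow> ennreal (std_normal_density x) = 0"
    by eventually_elim simp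
  then show ?thesis
    by (subst emeasure_density) (auto simp: nn_integral_0_iff_AE intro!: AE_I2 elim: eventually_mono split: split_indicator)
qed

text \<open>The normal law has no atoms, so a set whose frontier is at most one point is a
  continuity set of the limit, and weak convergence carries over to its probability.\<close>

lemma pmf_levy_continuity:
  fixes X :: "nat \<Rightarrow> 'a \<Rightarrow> real"
  assumes "\<And>t. (\<lambda>n. measure_pmf.expectation (P n) (\<lambda>x. iexp (t * X n x)))
            \<longlonglongrightarrow> complex_of_real (exp (- (t\<^sup>2) / 2))"
    and "S \<in> sets borel" "frontier S \<subseteq> {a}"
  shows "(\<lambda>n. measure_pmf.prob (P n) {x. X n x \<in> S}) \<longlonglongrightarrow> measure std_normal_distribution S"
proof -
  let ?\<mu> = "\<lambda>n. distr (measure_pmf (P n)) borel (X n)"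
  have rd: "real_distribution (?\<mu> n)" for n
    by (rule prob_space.real_distribution_distr[OF measure_pmf.prob_space_axioms]) simp
  have "weak_conv_m ?\<mu> std_normal_distribution"
    by (rule levy_continuity)
       (use assms(1) in \<open>auto simp: rd real_dist_normal_dist char_std_normal_distribution
          char_distr_measure_pmf\<close>)
  moreover have "emeasure std_normal_distribution (frontier S) = 0"
    using emeasure_mono[OF assms(3), of std_normal_distribution] emeasure_std_normal_singleton[of a]
    by simp
  ultimately have "(\<lambda>n. measure (?\<mu> n) S) \<longlonglongrightarrow> measure std_normal_distribution S"
    by (intro weak_conv_imp_continuity_set_conv rd real_dist_normal_dist assms(2))
  moreover have "measure (?\<mu> n) S = measure_pmf.prob (P n) {x. X n x \<in> S}" for n
    using assms(2) by (subst measure_distr) (auto simp: vimage_def)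
  ultimately show ?thesis
    by simp
qed

lemma std_normal_cdf_lessThan: "measure std_normal_distribution {..<a} = std_normal_cdf a"
proof -
  interpret real_distribution std_normal_distribution
    by (rule real_dist_normal_dist)
  have "measure std_normal_distribution ({..<a} \<union> {a}) =
      measure std_normal_distribution {..<a} + measure std_normal_distribution {a}"
    by (rule finite_measure_Union) auto
  moreover have "measure std_normal_distribution {a} = 0"
    by (simp add: measure_def emeasure_std_normal_singleton)
  moreover have "{..<a} \<union> {a} = {..a}"
    by auto
  ultimately show ?thesis
    by (simp add: std_normal_cdf_def cdf_def)
qed

text \<open>The test outputs 0 on a strict inequality and 1 on a weak one; this version serves the
  first event and \<open>pmf_levy_prob_ge\<close> the second.\<close>

lemma pmf_levy_prob_less:
  fixes X :: "nat \<Rightarrow> 'a \<Rightarrow> real"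
  assumes "\<And>t. (\<lambda>n. measure_pmf.expectation (P n) (\<lambda>x. iexp (t * X n x)))
            \<longlonglongrightarrow> complex_of_real (exp (- (t\<^sup>2) / 2))"
  shows "(\<lambda>n. measure_pmf.prob (P n) {x. X n x < a}) \<longlonglongrightarrow> std_normal_cdf a"
  using pmf_levy_continuity[OF assms, of "{..<a}" a]
  by (simp add: std_normal_cdf_lessThan frontier_real_lessThan)

lemma pmf_levy_prob_ge:
  fixes X :: "nat \<Rightarrow> 'a \<Rightarrow> real"
  assumes "\<And>t. (\<lambda>n. measure_pmf.expectation (P n) (\<lambda>x. iexp (t * X n x)))
            \<longlonglongrightarrow> complex_of_real (exp (- (t\<^sup>2) / 2))"
  shows "(\<lambda>n. measure_pmf.prob (P n) {x. X n x \<ge> a}) \<longlonglongrightarrow> std_normal_cdf (- a)"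
proof -
  \<comment> \<open>The limit is even in \<open>t\<close>, so \<open>- X n\<close> has the same
    limit law. This turns the event into a closed lower half-line, whose normal mass is the cdf by
    definition.\<close>
  have "(\<lambda>n. measure_pmf.expectation (P n) (\<lambda>x. iexp (t * - X n x)))
          \<longlonglongrightarrow> complex_of_real (exp (- (t\<^sup>2) / 2))" for t
    using assms[of "- t"] by simp
  from pmf_levy_continuity[OF this, of "{..- a}" "- a"] show ?thesis
    by (simp add: std_normal_cdf_def cdf_def frontier_real_atMost)
qed

section \<open>Characteristic function of a centered Bernoulli variable\<close>

definition bernoulli_char :: "real \<Rightarrow> real \<Rightarrow> complex" where
  "bernoulli_char p u = p * iexp (u * (1 - p)) + (1 - p) * iexp (- (u * p))"

lemma expectation_bernoulli_iexp:
  assumes "0 \<le> p" "p \<le> 1"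
  shows "measure_pmf.expectation (bernoulli_pmf p) (\<lambda>b. iexp (u * (of_bool b - p))) = bernoulli_char p u"
  using assms by (simp add: bernoulli_char_def integral_measure_pmf[of UNIV] UNIV_bool scaleR_conv_of_real)

lemma norm_convex_combination_le:
  fixes x y :: complex
  assumes "0 \<le> p" "p \<le> 1"
  shows "cmod (complex_of_real p * x + (1 - complex_of_real p) * y) \<le> p * cmod x + (1 - p) * cmod y"
proof -
  have "cmod (complex_of_real p * x + complex_of_real (1 - p) * y)
      \<le> cmod (complex_of_real p * x) + cmod (complex_of_real (1 - p) * y)"
    by (rule norm_triangle_ineq)
  then show ?thesis
    using assms unfolding norm_mult norm_of_real by simp
qed

lemma norm_bernoulli_char_le_1:
  assumes "0 \<le> p" "p \<le> 1"
  shows "cmod (bernoulli_char p u) \<le> 1"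
  using norm_convex_combination_le[OF assms, of "iexp (u * (1 - p))" "iexp (- (u * p))"]
  by (simp add: bernoulli_char_def)

text \<open>Since the variable is centered, the linear terms of the two exponentials cancel. What
  remains is a convex combination of Taylor remainders.\<close>

lemma norm_bernoulli_char_minus_1:
  assumes "0 \<le> p" "p \<le> 1"
  shows "cmod (bernoulli_char p u - 1) \<le> u\<^sup>2 / 2"
proof -
  define r where "r = (\<lambda>x. iexp x - (1 + \<i> * complex_of_real x))"
  have r: "cmod (r x) \<le> u\<^sup>2 / 2" if "\<bar>x\<bar> \<le> \<bar>u\<bar>" for x
    using iexp_approx1[of x 1] power_mono[OF that, of 2] by (simp add: r_def numeral_2_eq_2)
  have "bernoulli_char p u - 1 = p * r (u * (1 - p)) + (1 - p) * r (- (u * p))"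
    by (simp add: bernoulli_char_def r_def algebra_simps)
  also have "cmod \<dots> \<le> p * cmod (r (u * (1 - p))) + (1 - p) * cmod (r (- (u * p)))"
    using norm_convex_combination_le[OF assms] by simp
  also have "\<dots> \<le> p * (u\<^sup>2 / 2) + (1 - p) * (u\<^sup>2 / 2)"
    using assms by (intro add_mono mult_left_mono r) (auto simp: abs_mult mult_left_le)
  finally show ?thesis
    by (simp add: field_simps)
qed

text \<open>One order further: the quadratic terms add up to the variance, as p(1-p)^2 + (1-p)p^2 =
  p(1-p).\<close>

lemma norm_bernoulli_char_minus_quadratic:
  assumes "0 \<le> p" "p \<le> 1"
  shows "cmod (bernoulli_char p u - complex_of_real (1 - u\<^sup>2 * (p * (1 - p)) / 2)) \<le> \<bar>u\<bar> ^ 3 / 6"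
proof -
  define r where "r = (\<lambda>x. iexp x - (1 + \<i> * complex_of_real x - complex_of_real (x\<^sup>2) / 2))"
  have r: "cmod (r x) \<le> \<bar>u\<bar> ^ 3 / 6" if "\<bar>x\<bar> \<le> \<bar>u\<bar>" for x
    using iexp_approx1[of x 2] power_mono[OF that, of 3]
    by (simp add: r_def eval_nat_numeral power_mult_distrib algebra_simps)
  have "bernoulli_char p u - complex_of_real (1 - u\<^sup>2 * (p * (1 - p)) / 2)
      = p * r (u * (1 - p)) + (1 - p) * r (- (u * p))"
    by (simp add: bernoulli_char_def r_def field_simps power2_eq_square)
  also have "cmod \<dots> \<le> p * cmod (r (u * (1 - p))) + (1 - p) * cmod (r (- (u * p)))"
    using norm_convex_combination_le[OF assms] by simp
  also have "\<dots> \<le> p * (\<bar>u\<bar> ^ 3 / 6) + (1 - p) * (\<bar>u\<bar> ^ 3 / 6)"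
    using assms by (intro add_mono mult_left_mono r) (auto simp: abs_mult mult_left_le)
  also have "\<dots> = \<bar>u\<bar> ^ 3 / 6"
    by (simp add: field_simps)
  finally show ?thesis .
qed

text \<open>The central limit theorem for \<open>N\<close> Bernoulli variables. For two numbers in
  the unit disc the \<open>N\<close>-th powers differ by at most \<open>N\<close> times the
  difference of the bases. Here the bases differ by O(N^(-3/2)), so the powers differ by
  O(N^(-1/2)).\<close>

lemma bernoulli_char_power_tendsto:
  assumes "0 < p" "p < 1"
  shows "(\<lambda>N. bernoulli_char p (t / sqrt (real N * p * (1 - p))) ^ N)
           \<longlonglongrightarrow> complex_of_real (exp (- (t\<^sup>2) / 2))"
proof -
  define v where "v = p * (1 - p)"
  have v: "v > 0"
    using assms by (simp add: v_def)
  define u where "u = (\<lambda>N. t / sqrt (real N * v))"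
  have bound: "\<forall>\<^sub>F N in sequentially.
      cmod (bernoulli_char p (u N) ^ N - complex_of_real ((1 + (- (t\<^sup>2) / 2) / real N) ^ N))
        \<le> \<bar>t\<bar> ^ 3 / (6 * v * sqrt v) * (1 / sqrt (real N))"
  proof (rule eventually_sequentiallyI)
    fix N :: nat
    \<comment> \<open>From t^2/4 on, the real number 1 - t^2/(2N) is at least -1 and hence in the
      unit disc, as the comparison of powers requires.\<close>
    assume N: "N \<ge> max 1 (nat \<lceil>t\<^sup>2 / 4\<rceil>)"
    then have N0: "N > 0" and N1: "t\<^sup>2 / 4 \<le> real N"
      by linarith+
    have u2: "(u N)\<^sup>2 * v = t\<^sup>2 / real N"
      using v N0 by (simp add: u_def power_divide)
    have approx: "cmod (bernoulli_char p (u N) - complex_of_real (1 + (- (t\<^sup>2) / 2) / real N)) \<le> \<bar>u N\<bar> ^ 3 / 6"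
      using norm_bernoulli_char_minus_quadratic[of p "u N"] assms
      by (simp only: u2[unfolded v_def] less_imp_le) (simp add: field_simps)
    have "\<bar>1 + (- (t\<^sup>2) / 2) / real N\<bar> \<le> 1"
      using N0 N1 by (intro abs_leI) (auto simp: field_simps)
    then have "cmod (complex_of_real (1 + (- (t\<^sup>2) / 2) / real N)) \<le> 1"
      by (simp only: norm_of_real)
    then have "cmod (bernoulli_char p (u N) ^ N - complex_of_real (1 + (- (t\<^sup>2) / 2) / real N) ^ N)
        \<le> N * cmod (bernoulli_char p (u N) - complex_of_real (1 + (- (t\<^sup>2) / 2) / real N))"
      using assms by (intro norm_power_diff norm_bernoulli_char_le_1) auto
    also have "\<dots> \<le> N * (\<bar>u N\<bar> ^ 3 / 6)"
      by (intro mult_left_mono approx) simp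
    also have "\<dots> = \<bar>t\<bar> ^ 3 / (6 * v * sqrt v) * (1 / sqrt (real N))"
    proof -
      have "(sqrt (real N * v)) ^ 3 = real N * v * sqrt (real N) * sqrt v"
        using v by (simp add: power3_eq_cube real_sqrt_mult algebra_simps)
      then show ?thesis
        using v N0 by (simp add: u_def power_divide field_simps)
    qed
    finally show "cmod (bernoulli_char p (u N) ^ N - complex_of_real ((1 + (- (t\<^sup>2) / 2) / real N) ^ N))
        \<le> \<bar>t\<bar> ^ 3 / (6 * v * sqrt v) * (1 / sqrt (real N))"
      by (simp only: of_real_power)
  qed
  have "(\<lambda>N. \<bar>t\<bar> ^ 3 / (6 * v * sqrt v) * (1 / sqrt (real N))) \<longlonglongrightarrow> 0"
    by (intro tendsto_mult_right_zero tendsto_divide_0[OF tendsto_const]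
        filterlim_at_top_imp_at_infinity filterlim_compose[OF sqrt_at_top filterlim_real_sequentially])
  note null = Lim_null_comparison[OF bound this]
  have "(\<lambda>N. complex_of_real ((1 + (- (t\<^sup>2) / 2) / real N) ^ N)) \<longlonglongrightarrow> complex_of_real (exp (- (t\<^sup>2) / 2))"
    by (rule isCont_tendsto_compose[OF _ tendsto_exp_limit_sequentially]) auto
  then have "(\<lambda>N. bernoulli_char p (u N) ^ N) \<longlonglongrightarrow> complex_of_real (exp (- (t\<^sup>2) / 2))"
    by (rule Lim_transform) (rule null)
  then show ?thesis
    by (simp add: u_def v_def mult.assoc)
qed

section \<open>The edge count given the planted matching\<close>

lemma expectation_iexp_sum_Pi_pmf:
  fixes g :: "'a \<Rightarrow> 'b \<Rightarrow> real"
  assumes "finite I"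
  shows "measure_pmf.expectation (Pi_pmf I d P) (\<lambda>A. iexp (t * (\<Sum>i\<in>I. g i (A i))))
       = (\<Prod>i\<in>I. measure_pmf.expectation (P i) (\<lambda>x. iexp (t * g i x)))"
proof -
  let ?P = "measure_pmf (Pi_pmf I d P)"
  have "prob_space.indep_vars ?P (\<lambda>_. borel) (\<lambda>i A. g i (A i)) I"
    by (rule prob_space.indep_vars_compose2[OF measure_pmf.prob_space_axioms indep_vars_Pi_pmf])
       (use assms in auto)
  then have "char (distr ?P borel (\<lambda>A. \<Sum>i\<in>I. g i (A i))) t = (\<Prod>i\<in>I. char (distr ?P borel (\<lambda>A. g i (A i))) t)"
    by (rule prob_space.char_distr_sum[OF measure_pmf.prob_space_axioms])
  also have "\<dots> = (\<Prod>i\<in>I. measure_pmf.expectation (P i) (\<lambda>x. iexp (t * g i x)))"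
  proof (rule prod.cong)
    fix i assume "i \<in> I"
    then have "map_pmf (\<lambda>A. A i) (Pi_pmf I d P) = P i"
      using assms by (simp add: Pi_pmf_component)
    then have "measure_pmf.expectation (P i) (\<lambda>x. iexp (t * g i x))
        = measure_pmf.expectation (map_pmf (\<lambda>A. A i) (Pi_pmf I d P)) (\<lambda>x. iexp (t * g i x))"
      by simp
    then show "char (distr ?P borel (\<lambda>A. g i (A i))) t = measure_pmf.expectation (P i) (\<lambda>x. iexp (t * g i x))"
      by (simp add: char_distr_measure_pmf)
  qed simp
  finally show ?thesis
    by (simp add: char_distr_measure_pmf)
qed

text \<open>By independence the expectation factors over the edges; a planted edge contributes the
  constant 1 - p to the centered sum. The case \<open>M = {}\<close> is the null model.\<close>

lemma expectation_iexp_planted_edges: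
  assumes "finite E" "M \<subseteq> E" "0 \<le> p" "p \<le> 1"
  shows "measure_pmf.expectation
      (Pi_pmf E False (\<lambda>e. if e \<in> M then return_pmf True else bernoulli_pmf p))
      (\<lambda>A. iexp (u * (\<Sum>e\<in>E. of_bool (A e) - p)))
    = iexp (u * ((1 - p) * real (card M))) * bernoulli_char p u ^ (card E - card M)"
proof -
  have "measure_pmf.expectation
      (Pi_pmf E False (\<lambda>e. if e \<in> M then return_pmf True else bernoulli_pmf p))
      (\<lambda>A. iexp (u * (\<Sum>e\<in>E. of_bool (A e) - p)))
    = (\<Prod>e\<in>E. measure_pmf.expectation (if e \<in> M then return_pmf True else bernoulli_pmf p)
        (\<lambda>b. iexp (u * (of_bool b - p))))"
    by (rule expectation_iexp_sum_Pi_pmf[OF assms(1)])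
  also have "\<dots> = (\<Prod>e\<in>E. if e \<in> M then iexp (u * (1 - p)) else bernoulli_char p u)"
    using expectation_bernoulli_iexp[OF assms(3,4), of u] by (intro prod.cong) auto
  also have "\<dots> = iexp (u * (1 - p)) ^ card M * bernoulli_char p u ^ card (E - M)"
    using assms(1,2) by (simp add: prod.If_cases Int_absorb1 Diff_eq)
  also have "iexp (u * (1 - p)) ^ card M = iexp (u * ((1 - p) * real (card M)))"
    by (simp add: exp_of_nat_mult[symmetric] algebra_simps)
  also have "card (E - M) = card E - card M"
    using assms(1,2) by (simp add: card_Diff_subset finite_subset)
  finally show ?thesis .
qed

section \<open>Counting in matchings of a complete graph\<close>

lemma card_Union_matching:
  assumes "finite V" "M \<in> matchings (nsets V 2)"
  shows "card (\<Union>M) = 2 * card M"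
proof -
  have "card (\<Union>M) = sum card M"
    using assms by (intro card_Union_disjoint) (auto simp: matchings_def nsets_def)
  also have "\<dots> = (\<Sum>e\<in>M. 2)"
    using assms(2) by (intro sum.cong) (auto simp: matchings_def nsets_def)
  finally show ?thesis
    by simp
qed

lemma card_matching_le:
  assumes "finite V" "M \<in> matchings (nsets V 2)"
  shows "2 * card M \<le> card V"
proof -
  have "\<Union>M \<subseteq> V"
    using assms(2) by (auto simp: matchings_def nsets_def)
  then have "card (\<Union>M) \<le> card V"
    using assms(1) by (rule card_mono[rotated])
  then show ?thesis
    by (simp add: card_Union_matching[OF assms])
qed

lemma card_nsets: "finite V \<Longrightarrow> card (nsets V k) = card V choose k"
  using n_subsets[of V k] by (simp add: nsets_def finite_subset conj_commute cong: conj_cong)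

lemma of_nat_choose_two: "real (n choose 2) = real n * (real n - 1) / 2"
proof (cases n)
  case (Suc k)
  then show ?thesis
    by (simp add: choose_two real_of_nat_div algebra_simps)
qed simp

text \<open>
  Both sides sum over pairs of a matching and one of its edges; on the right the edge has been
  removed from the matching.
\<close>

lemma sum_matchings_remove_edge:
  fixes f :: "nat \<Rightarrow> real"
  assumes "finite V"
  defines "E \<equiv> nsets V 2"
  shows "(\<Sum>M\<in>matchings E. lam ^ card M * (real (card M) * f (card M)))
       = (\<Sum>M\<in>matchings E. lam ^ card M *
            (lam * real ((card V - 2 * card M) choose 2) * f (Suc (card M))))"
proof -
  have E: "finite E"
    using assms by (simp add: finite_imp_finite_nsets)
  have fin: "finite M" if "M \<in> matchings E" for M
    using that E by (auto simp: matchings_def intro: finite_subset)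
  have free: "card (nsets (V - \<Union>M) 2) = (card V - 2 * card M) choose 2" if "M \<in> matchings E" for M
  proof -
    have "\<Union>M \<subseteq> V"
      using that by (auto simp: matchings_def nsets_def E_def)
    then have "card (V - \<Union>M) = card V - card (\<Union>M)"
      using assms(1) by (intro card_Diff_subset) (auto intro: finite_subset)
    then show ?thesis
      using assms(1) card_Union_matching[OF assms(1)] that by (simp add: card_nsets E_def)
  qed
  \<comment> \<open>Ensures that inserting a free edge and then removing it gives back
    \<open>M\<close>.\<close>
  have free_notin: "e \<notin> M" if "e \<in> nsets (V - \<Union>M) 2" for e and M :: "'a set set"
  proof
    assume "e \<in> M"
    with that have "e = {}"
      by (auto simp: nsets_def)
    with that show False
      by (simp add: nsets_def)
  qed
  have "(\<Sum>M\<in>matchings E. lam ^ card M * (real (card M) * f (card M)))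
      = (\<Sum>M\<in>matchings E. \<Sum>e\<in>M. lam ^ card M * f (card M))"
    by (intro sum.cong) auto
  also have "\<dots> = (\<Sum>(M, e)\<in>(SIGMA M:matchings E. M). lam ^ card M * f (card M))"
    using E fin by (intro sum.Sigma) (auto simp: finite_matchings)
  also have "\<dots> = (\<Sum>(M, e)\<in>(SIGMA M:matchings E. nsets (V - \<Union>M) 2).
      lam ^ Suc (card M) * f (Suc (card M)))"
  \<comment> \<open>The five cases: \<open>i\<close> undoes \<open>j\<close>, \<open>j\<close> maps
    into the target, \<open>j\<close> undoes \<open>i\<close>, \<open>i\<close> maps into the
    source, and the summands agree.\<close>
  proof (rule sum.reindex_bij_witness[where i = "\<lambda>(M, e). (insert e M, e)" and j = "\<lambda>(M, e). (M - {e}, e)"], goal_cases)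
    case (1 x)
    then show ?case
      by auto
  next
    case (2 x)
    then obtain M e where x: "x = (M, e)" and M: "M \<in> matchings E" "e \<in> M"
      by auto
    have "e \<inter> \<Union>(M - {e}) = {}"
      using M by (force simp: matchings_def pairwise_def disjnt_def)
    moreover have "e \<in> nsets V 2"
      using M by (auto simp: matchings_def E_def)
    moreover have "M - {e} \<in> matchings E"
      using M by (auto simp: matchings_def intro: pairwise_subset)
    ultimately show ?case
      by (auto simp: x nsets_def)
  next
    case (3 y)
    then show ?case
      using free_notin by auto
  next
    case (4 y)
    then obtain M e where y: "y = (M, e)" and M: "M \<in> matchings E" "e \<in> nsets (V - \<Union>M) 2"
      by auto
    have "disjnt e e'" if "e' \<in> M" for e'
      using that M(2) by (auto simp: nsets_def disjnt_def)
    then have "insert e M \<in> matchings E"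
      using M by (auto simp: matchings_def E_def pairwise_insert disjnt_sym nsets_def)
    then show ?case
      by (simp add: y)
  next
    case (5 x)
    then obtain M e where x: "x = (M, e)" and M: "M \<in> matchings E" "e \<in> M"
      by auto
    have "card M = Suc (card (M - {e}))"
      using card_Suc_Diff1[OF fin[OF M(1)] M(2)] by simp
    then show ?case
      by (simp add: x)
  qed
  also have "\<dots> = (\<Sum>M\<in>matchings E. \<Sum>e\<in>nsets (V - \<Union>M) 2. lam ^ Suc (card M) * f (Suc (card M)))"
    using E assms(1) by (intro sum.Sigma[symmetric]) (auto simp: finite_matchings finite_imp_finite_nsets)
  also have "\<dots> = (\<Sum>M\<in>matchings E. lam ^ card M *
      (lam * real ((card V - 2 * card M) choose 2) * f (Suc (card M))))"
    using free by (intro sum.cong) (auto simp: algebra_simps)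
  finally show ?thesis .
qed

section \<open>Concentration of the size of a monomer-dimer matching\<close>

lemma expectation_monomer_dimer:
  fixes h :: "'a set set \<Rightarrow> real"
  assumes "finite E" "lam \<ge> 0"
  shows "measure_pmf.expectation (monomer_dimer E lam) h
       = (\<Sum>M\<in>matchings E. lam ^ card M * h M) / matching_partition E lam"
proof -
  have "measure_pmf.expectation (monomer_dimer E lam) h
      = (\<Sum>M\<in>matchings E. h M * pmf (monomer_dimer E lam) M)"
    using assms by (intro integral_measure_pmf_real)
      (auto simp: finite_matchings set_pmf_iff pmf_monomer_dimer split: if_splits)
  also have "\<dots> = (\<Sum>M\<in>matchings E. lam ^ card M * h M) / matching_partition E lam"
    using assms by (simp add: pmf_monomer_dimer sum_divide_distrib mult.commute)
  finally show ?thesis .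
qed

lemma set_pmf_monomer_dimer:
  assumes "finite E" "lam \<ge> 0"
  shows "set_pmf (monomer_dimer E lam) \<subseteq> matchings E"
  using assms by (auto simp: set_pmf_iff pmf_monomer_dimer split: if_splits)

lemma integrable_monomer_dimer:
  fixes h :: "'a set set \<Rightarrow> 'b :: {banach, second_countable_topology}"
  assumes "finite E" "lam \<ge> 0"
  shows "integrable (measure_pmf (monomer_dimer E lam)) h"
  using finite_subset[OF set_pmf_monomer_dimer finite_matchings] assms
  by (intro integrable_measure_pmf_finite) auto

text \<open>
  The number \<open>c * n / 2\<close> is where the birth rate \<open>lam * (n - 2 * k)\<^sup>2 / 2\<close> of edges equals
  their death rate \<open>k\<close>. As the difference of the rates is monotone in \<open>k\<close>, testing the identity
  \<open>sum_matchings_remove_edge\<close> with \<open>f k = k - c * n / 2\<close> controls the variance.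
\<close>

lemma matching_size_second_moment:
  fixes V :: "'a set" and \<zeta> c :: real
  assumes "finite V" "card V > 0" "\<zeta> > 0" "0 < c" "c < 1" "\<zeta> * c = (1 - c)\<^sup>2"
  defines "n \<equiv> real (card V)"
  shows "measure_pmf.expectation (monomer_dimer (nsets V 2) (1 / (\<zeta> * n)))
           (\<lambda>M. (real (card M) - c * n / 2)\<^sup>2) \<le> n / \<zeta>"
proof -
  define E where "E = nsets V 2"
  define lam where "lam = 1 / (\<zeta> * n)"
  define m where "m = c * n / 2"
  have n: "n > 0"
    using assms by simp
  have lam: "lam > 0"
    using n assms(3) by (simp add: lam_def)
  have E: "finite E"
    using assms(1) by (simp add: E_def finite_imp_finite_nsets)
  define Ex where "Ex h = measure_pmf.expectation (monomer_dimer E lam) h" for h :: "'a set set \<Rightarrow> real"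
  \<comment> \<open>The birth rate at \<open>M\<close>: weight \<open>lam\<close> for each edge that
    avoids the vertices covered by \<open>M\<close>.\<close>
  define G where "G = (\<lambda>M :: 'a set set. lam * real ((card V - 2 * card M) choose 2))"
  have int: "integrable (measure_pmf (monomer_dimer E lam)) h" for h :: "'a set set \<Rightarrow> real"
    using E lam by (intro integrable_monomer_dimer) auto
  have mono: "Ex h \<le> Ex h'" if "\<And>M. M \<in> matchings E \<Longrightarrow> h M \<le> h' M" for h h'
    unfolding Ex_def using set_pmf_monomer_dimer[of E lam] E lam that
    by (intro integral_mono_AE int AE_pmfI) auto
  have "Ex (\<lambda>M. real (card M) * (real (card M) - m)) = Ex (\<lambda>M. G M * (real (Suc (card M)) - m))"
    using sum_matchings_remove_edge[OF assms(1), of lam "\<lambda>k. real k - m"] E lam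
    unfolding Ex_def by (subst (1 2) expectation_monomer_dimer) (auto simp: G_def E_def)
  \<comment> \<open>The right-hand side comes from the extra 1 in
    \<open>Suc (card M)\<close>.\<close>
  then have identity: "Ex (\<lambda>M. (real (card M) - G M) * (real (card M) - m)) = Ex G"
    unfolding Ex_def by (simp add: algebra_simps int)
  have lam_n2: "lam * n\<^sup>2 = n / \<zeta>"
    using n assms(3) by (simp add: lam_def power2_eq_square field_simps)
  \<comment> \<open>The quadratic equation for \<open>c\<close> enters here. At size
    \<open>m\<close> exactly n(1-c) vertices would be uncovered, and the rate is taken with y^2 in
    place of y(y-1).\<close>
  have balance: "m = lam * (n * (1 - c))\<^sup>2 / 2"
  proof -
    have "lam * (n * (1 - c))\<^sup>2 = lam * n\<^sup>2 * (\<zeta> * c)"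
      by (simp add: assms(6) power_mult_distrib)
    also have "\<dots> = c * n"
      using lam_n2 assms(3) by simp
    finally show ?thesis
      by (simp add: m_def)
  qed
  \<comment> \<open>Equivalently, (m - G)(k - m) is nonnegative up to an error: a size above
    \<open>m\<close> has a birth rate below \<open>m\<close>, except for the gap between y^2 and
    y(y-1). The term \<open>n / (2 * \<zeta>)\<close>, which is lam n^2/2, absorbs that gap.\<close>
  have pointwise: "(real (card M) - m)\<^sup>2 \<le> (real (card M) - G M) * (real (card M) - m) + n / (2 * \<zeta>)"
    and G_le: "G M \<le> n / (2 * \<zeta>)" if M: "M \<in> matchings E" for M
  proof -
    define k where "k = real (card M)"
    define y where "y = n - 2 * k"
    have le: "2 * card M \<le> card V"
      using card_matching_le[OF assms(1)] M by (simp add: E_def)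
    have y: "0 \<le> y" "y \<le> n"
      using le by (auto simp: y_def k_def n_def)
    have "real ((card V - 2 * card M) choose 2) = y * (y - 1) / 2"
      using le by (simp add: of_nat_choose_two y_def k_def n_def of_nat_diff)
    then have G: "G M = lam * (y * (y - 1) / 2)"
      by (simp add: G_def)
    have "y * (y - 1) \<le> n\<^sup>2"
      using y mult_mono[of y n y n] by (simp add: power2_eq_square algebra_simps)
    then have "lam * (y * (y - 1)) \<le> n / \<zeta>"
      using lam by (subst lam_n2[symmetric]) (intro mult_left_mono; simp)
    then show "G M \<le> n / (2 * \<zeta>)"
      by (simp add: G)
    have km: "k - m = (n * (1 - c) - y) / 2"
      by (simp add: y_def m_def field_simps)
    have "(k - G M) * (k - m) + n / (2 * \<zeta>) - (k - m)\<^sup>2 = (m - G M) * (k - m) + n / (2 * \<zeta>)"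
      by (simp add: power2_eq_square algebra_simps)
    \<comment> \<open>By \<open>balance\<close>, m - G is lam/2 times (n(1-c))^2 - y^2 + y. The
      difference of squares has the factor n(1-c) - y = 2(k - m), which yields the square; the
      leftover y is the correction term.\<close>
    also have "\<dots> = lam * (k - m)\<^sup>2 * (n * (1 - c) + y) + lam * (y * (k - m) + n\<^sup>2) / 2"
    proof -
      have "m - G M = lam * ((k - m) * (n * (1 - c) + y)) + lam * y / 2"
        by (subst balance) (simp add: G km power2_eq_square field_simps)
      moreover have "n / (2 * \<zeta>) = lam * n\<^sup>2 / 2"
        by (simp add: lam_n2)
      ultimately show ?thesis
        by (simp only:) (simp add: power2_eq_square field_simps)
    qed
    also have "\<dots> \<ge> 0"
    proof -
      have "c * n \<le> n"
        using mult_right_mono[of c 1 n] assms(5) n by linarith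
      moreover have "k \<ge> 0"
        by (simp add: k_def)
      ultimately have "m - k \<le> n"
        using n unfolding m_def by linarith
      then have "y * (m - k) \<le> n * n"
        using mult_left_mono[of "m - k" n y] mult_right_mono[of y n n] y n by linarith
      then have "y * (k - m) + n\<^sup>2 \<ge> 0"
        by (simp add: power2_eq_square algebra_simps)
      then have "lam * (y * (k - m) + n\<^sup>2) \<ge> 0"
        by (rule mult_nonneg_nonneg[OF less_imp_le[OF lam]])
      moreover have "lam * (k - m)\<^sup>2 * (n * (1 - c) + y) \<ge> 0"
        using lam y n assms(5) by simp
      ultimately show ?thesis
        by simp
    qed
    finally show "(real (card M) - m)\<^sup>2 \<le> (real (card M) - G M) * (real (card M) - m) + n / (2 * \<zeta>)"
      by (simp add: k_def)
  qed
  have "Ex (\<lambda>M. (real (card M) - m)\<^sup>2)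
      \<le> Ex (\<lambda>M. (real (card M) - G M) * (real (card M) - m) + n / (2 * \<zeta>))"
    by (intro mono pointwise)
  also have "\<dots> = Ex G + n / (2 * \<zeta>)"
    unfolding identity[symmetric] by (simp add: Ex_def int)
  also have "\<dots> \<le> Ex (\<lambda>_. n / (2 * \<zeta>)) + n / (2 * \<zeta>)"
    by (intro add_right_mono mono G_le)
  finally show ?thesis
    by (simp add: Ex_def E_def lam_def m_def)
qed

text \<open>The phase error is linear in the deviation, so a first moment is wanted. As the second
  moment is O(n), splitting at \<open>sqrt n\<close> bounds the first by O(sqrt n).\<close>

lemma matching_size_abs_deviation:
  fixes V :: "'a set" and \<zeta> c :: real
  assumes "finite V" "card V > 0" "\<zeta> > 0" "0 < c" "c < 1" "\<zeta> * c = (1 - c)\<^sup>2"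
  defines "n \<equiv> real (card V)"
  shows "measure_pmf.expectation (monomer_dimer (nsets V 2) (1 / (\<zeta> * n)))
           (\<lambda>M. \<bar>real (card M) - c * n / 2\<bar>) \<le> (1 + 1 / \<zeta>) * sqrt n"
proof -
  let ?P = "monomer_dimer (nsets V 2) (1 / (\<zeta> * n))"
  have n: "n > 0"
    using assms by simp
  have int: "integrable (measure_pmf ?P) h" for h :: "'a set set \<Rightarrow> real"
    using assms n by (intro integrable_monomer_dimer) (auto simp: finite_imp_finite_nsets)
  have am_gm: "\<bar>x\<bar> \<le> x\<^sup>2 / sqrt n + sqrt n" for x
  proof (cases "\<bar>x\<bar> \<le> sqrt n")
    case True
    then show ?thesis
      using n by (simp add: add_increasing)
  next
    case False
    then have "\<bar>x\<bar> * sqrt n \<le> \<bar>x\<bar> * \<bar>x\<bar>"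
      by (intro mult_left_mono) auto
    then have "\<bar>x\<bar> \<le> x\<^sup>2 / sqrt n"
      using n by (simp add: field_simps power2_eq_square)
    then show ?thesis
      using n by (simp add: add_increasing2)
  qed
  have "measure_pmf.expectation ?P (\<lambda>M. \<bar>real (card M) - c * n / 2\<bar>)
      \<le> measure_pmf.expectation ?P (\<lambda>M. (real (card M) - c * n / 2)\<^sup>2 / sqrt n + sqrt n)"
    by (intro integral_mono int am_gm)
  also have "\<dots> = measure_pmf.expectation ?P (\<lambda>M. (real (card M) - c * n / 2)\<^sup>2) / sqrt n + sqrt n"
    by (simp add: int)
  also have "\<dots> \<le> (n / \<zeta>) / sqrt n + sqrt n"
    using matching_size_second_moment[OF assms(1-6)] n
    by (intro add_right_mono divide_right_mono) (auto simp: n_def)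
  also have "\<dots> = (1 + 1 / \<zeta>) * sqrt n"
  proof -
    have "n / \<zeta> / sqrt n = n / sqrt n / \<zeta>"
      by simp
    then show ?thesis
      using n by (simp only: real_div_sqrt less_imp_le) (simp add: algebra_simps)
  qed
  finally show ?thesis .
qed

section \<open>Characteristic functions of the two models and their limits\<close>

lemma finite_complete_edges: "finite (complete_edges n)"
  by (simp add: complete_edges_def finite_imp_finite_nsets)

lemma card_complete_edges: "card (complete_edges n) = n choose 2"
  by (simp add: complete_edges_def card_nsets)

lemma expectation_iexp_planted_matching:
  assumes "0 \<le> p" "p \<le> 1" "lam \<ge> 0"
  shows "measure_pmf.expectation (planted_matching n p lam) (\<lambda>A. iexp (u * centered_edge_count n p A))
       = measure_pmf.expectation (monomer_dimer (complete_edges n) lam)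
           (\<lambda>M. iexp (u * ((1 - p) * real (card M))) * bernoulli_char p u ^ ((n choose 2) - card M))"
proof -
  let ?E = "complete_edges n"
  let ?f = "\<lambda>M. Pi_pmf ?E False (\<lambda>e. if e \<in> M then return_pmf True else bernoulli_pmf p)"
  have fin: "finite (set_pmf (?f M))" for M
    by (simp add: set_Pi_pmf finite_complete_edges finite_PiE_dflt)
  have "measure_pmf.expectation (planted_matching n p lam) (\<lambda>A. iexp (u * centered_edge_count n p A))
      = (\<Sum>M\<in>matchings ?E. pmf (monomer_dimer ?E lam) M *\<^sub>R
          measure_pmf.expectation (?f M) (\<lambda>A. iexp (u * centered_edge_count n p A)))"
    unfolding planted_matching_def using assms(3)
    by (intro pmf_expectation_bind fin set_pmf_monomer_dimer finite_matchings finite_complete_edges)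
  also have "\<dots> = (\<Sum>M\<in>matchings ?E. pmf (monomer_dimer ?E lam) M *\<^sub>R
      (iexp (u * ((1 - p) * real (card M))) * bernoulli_char p u ^ ((n choose 2) - card M)))"
  proof (rule sum.cong)
    fix M assume "M \<in> matchings ?E"
    then have "M \<subseteq> ?E"
      by (simp add: matchings_def)
    then show "pmf (monomer_dimer ?E lam) M *\<^sub>R
          measure_pmf.expectation (?f M) (\<lambda>A. iexp (u * centered_edge_count n p A))
        = pmf (monomer_dimer ?E lam) M *\<^sub>R
          (iexp (u * ((1 - p) * real (card M))) * bernoulli_char p u ^ ((n choose 2) - card M))"
      using expectation_iexp_planted_edges[OF finite_complete_edges _ assms(1,2)]
      by (simp only: centered_edge_count_def card_complete_edges)
  qed simp
  also have "\<dots> = measure_pmf.expectation (monomer_dimer ?E lam)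
      (\<lambda>M. iexp (u * ((1 - p) * real (card M))) * bernoulli_char p u ^ ((n choose 2) - card M))"
    using set_pmf_monomer_dimer[OF finite_complete_edges assms(3)]
    by (intro integral_measure_pmf[symmetric]) (auto simp: finite_matchings finite_complete_edges)
  finally show ?thesis .
qed

lemma expectation_iexp_erdos_renyi:
  assumes "0 \<le> p" "p \<le> 1"
  shows "measure_pmf.expectation (erdos_renyi n p) (\<lambda>A. iexp (u * centered_edge_count n p A))
       = bernoulli_char p u ^ (n choose 2)"
  using expectation_iexp_planted_edges[OF finite_complete_edges empty_subsetI assms, of n u]
  by (simp only: centered_edge_count_def erdos_renyi_def card_complete_edges) simp

lemma filterlim_choose_two: "filterlim (\<lambda>n. n choose 2) at_top sequentially"
proof (rule filterlim_at_top_mono[OF filterlim_ident])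
  show "\<forall>\<^sub>F n in sequentially. n \<le> n choose 2"
    using eventually_gt_at_top[of 2] by eventually_elim (simp add: upper_le_binomial)
qed

lemma erdos_renyi_char_tendsto:
  assumes "0 < p" "p < 1"
  shows "(\<lambda>n. measure_pmf.expectation (erdos_renyi n p)
            (\<lambda>A. iexp (t * (centered_edge_count n p A / sqrt (real (n choose 2) * p * (1 - p))))))
         \<longlonglongrightarrow> complex_of_real (exp (- (t\<^sup>2) / 2))"
proof -
  have "measure_pmf.expectation (erdos_renyi n p)
          (\<lambda>A. iexp (t * (centered_edge_count n p A / sqrt (real (n choose 2) * p * (1 - p)))))
      = bernoulli_char p (t / sqrt (real (n choose 2) * p * (1 - p))) ^ (n choose 2)" for n
    using expectation_iexp_erdos_renyi[of p n "t / sqrt (real (n choose 2) * p * (1 - p))"] assms by simp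
  then show ?thesis
    using filterlim_compose[OF bernoulli_char_power_tendsto[OF assms] filterlim_choose_two] by simp
qed

text \<open>After a power of norm at most 1 is factored out, the phase and the \<open>k\<close>
  missing factors are each compared with 1. The phase costs at most |x| and, thanks to centering,
  each factor only u^2/2.\<close>

lemma norm_shifted_power_diff_le:
  assumes "0 \<le> p" "p \<le> 1" "k \<le> N"
  shows "cmod (iexp x * bernoulli_char p u ^ (N - k) - bernoulli_char p u ^ N)
       \<le> \<bar>x\<bar> + real k * (u\<^sup>2 / 2)"
proof -
  let ?z = "bernoulli_char p u"
  have z: "cmod ?z \<le> 1"
    using assms by (intro norm_bernoulli_char_le_1)
  then have zj: "cmod (?z ^ (N - k)) \<le> 1"
    by (simp add: norm_power power_le_one)
  have "?z ^ N = ?z ^ (N - k) * ?z ^ k"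
    using assms(3) by (simp flip: power_add)
  then have "iexp x * ?z ^ (N - k) - ?z ^ N = ?z ^ (N - k) * ((iexp x - 1) - (?z ^ k - 1 ^ k))"
    by (simp add: algebra_simps)
  also have "cmod \<dots> \<le> cmod ((iexp x - 1) - (?z ^ k - 1 ^ k))"
    using mult_right_mono[OF zj] by (simp add: norm_mult)
  also have "\<dots> \<le> cmod (iexp x - 1) + cmod (?z ^ k - 1 ^ k)"
    by (rule norm_triangle_ineq4)
  also have "\<dots> \<le> \<bar>x\<bar> + real k * cmod (?z - 1)"
    using iexp_approx1[of x 0] z by (intro add_mono norm_power_diff) auto
  also have "\<dots> \<le> \<bar>x\<bar> + real k * (u\<^sup>2 / 2)"
    using assms by (intro add_left_mono mult_left_mono norm_bernoulli_char_minus_1) auto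
  finally show ?thesis .
qed

text \<open>The phase \<open>b\<close> stands for the expected limit shift. The three error terms
  come from the fluctuation of |M| about cn/2, from the mismatch between the phase at cn/2 and
  \<open>b\<close>, and from the random factors that planted edges replace.\<close>

lemma planted_matching_char_bound:
  fixes p \<zeta> c b u :: real
  assumes p: "0 < p" "p < 1" and c: "\<zeta> > 0" "0 < c" "c < 1" "\<zeta> * c = (1 - c)\<^sup>2" and n: "n > 0"
  shows "cmod (iexp (- b) *
      measure_pmf.expectation (planted_matching n p (1 / (\<zeta> * real n))) (\<lambda>A. iexp (u * centered_edge_count n p A))
      - bernoulli_char p u ^ (n choose 2))
    \<le> (1 + 1 / \<zeta>) * (\<bar>u\<bar> * sqrt n) + \<bar>u * ((1 - p) * (c * n / 2)) - b\<bar> + real n * u\<^sup>2"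
proof -
  let ?E = "complete_edges n"
  let ?P = "monomer_dimer ?E (1 / (\<zeta> * real n))"
  let ?m = "c * real n / 2"
  let ?z = "bernoulli_char p u"
  have lam: "1 / (\<zeta> * real n) \<ge> 0"
    using c by simp
  have int: "integrable (measure_pmf ?P) h" for h :: "nat set set \<Rightarrow> 'b :: {banach, second_countable_topology}"
    by (rule integrable_monomer_dimer[OF finite_complete_edges lam])
  have pointwise: "cmod (iexp (- b) * (iexp (u * ((1 - p) * real (card M))) * ?z ^ ((n choose 2) - card M)) - ?z ^ (n choose 2))
      \<le> \<bar>u\<bar> * \<bar>real (card M) - ?m\<bar> + (\<bar>u * ((1 - p) * ?m) - b\<bar> + real n * u\<^sup>2)"
    if "M \<in> set_pmf ?P" for M
  proof -
    have M: "M \<in> matchings ?E"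
      using that set_pmf_monomer_dimer[OF finite_complete_edges lam] by auto
    then have "card M \<le> card ?E"
      by (intro card_mono finite_complete_edges) (simp add: matchings_def)
    then have "cmod (iexp (u * ((1 - p) * real (card M)) - b) * ?z ^ ((n choose 2) - card M) - ?z ^ (n choose 2))
        \<le> \<bar>u * ((1 - p) * real (card M)) - b\<bar> + real (card M) * (u\<^sup>2 / 2)"
      using p by (intro norm_shifted_power_diff_le) (auto simp: card_complete_edges)
    also have "real (card M) * (u\<^sup>2 / 2) \<le> real n * u\<^sup>2"
      using card_matching_le[of "{1..n}" M] M by (intro mult_mono) (auto simp: complete_edges_def)
    also have "\<bar>u * ((1 - p) * real (card M)) - b\<bar>
        \<le> \<bar>u * ((1 - p) * (real (card M) - ?m))\<bar> + \<bar>u * ((1 - p) * ?m) - b\<bar>"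
      by (rule order_trans[OF _ abs_triangle_ineq]) (simp add: algebra_simps)
    also have "\<bar>u * ((1 - p) * (real (card M) - ?m))\<bar> \<le> \<bar>u\<bar> * \<bar>real (card M) - ?m\<bar>"
      using p by (simp add: abs_mult mult_left_mono mult_left_le_one_le)
    finally have "cmod (iexp (u * ((1 - p) * real (card M)) - b) * ?z ^ ((n choose 2) - card M) - ?z ^ (n choose 2))
        \<le> \<bar>u\<bar> * \<bar>real (card M) - ?m\<bar> + \<bar>u * ((1 - p) * ?m) - b\<bar> + real n * u\<^sup>2"
      by simp
    moreover have "iexp (u * ((1 - p) * real (card M)) - b) = iexp (- b) * iexp (u * ((1 - p) * real (card M)))"
      by (simp add: algebra_simps flip: exp_add)
    ultimately show ?thesis
      by (simp only: mult.assoc add.assoc)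
  qed
  have "cmod (iexp (- b) *
      measure_pmf.expectation (planted_matching n p (1 / (\<zeta> * real n))) (\<lambda>A. iexp (u * centered_edge_count n p A))
      - ?z ^ (n choose 2))
    = cmod (measure_pmf.expectation ?P (\<lambda>M. iexp (- b) *
        (iexp (u * ((1 - p) * real (card M))) * ?z ^ ((n choose 2) - card M)) - ?z ^ (n choose 2)))"
    using p lam by (subst expectation_iexp_planted_matching) (auto simp: int)
  also have "\<dots> \<le> measure_pmf.expectation ?P
      (\<lambda>M. \<bar>u\<bar> * \<bar>real (card M) - ?m\<bar> + (\<bar>u * ((1 - p) * ?m) - b\<bar> + real n * u\<^sup>2))"
    by (rule order_trans[OF integral_norm_bound]) (intro integral_mono_AE int AE_pmfI pointwise)
  also have "\<dots> = \<bar>u\<bar> * measure_pmf.expectation ?P (\<lambda>M. \<bar>real (card M) - ?m\<bar>)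
      + (\<bar>u * ((1 - p) * ?m) - b\<bar> + real n * u\<^sup>2)"
    by (simp add: int)
  also have "\<dots> \<le> \<bar>u\<bar> * ((1 + 1 / \<zeta>) * sqrt n) + (\<bar>u * ((1 - p) * ?m) - b\<bar> + real n * u\<^sup>2)"
    using matching_size_abs_deviation[of "{1..n}", OF _ _ c] n
    by (intro add_right_mono mult_left_mono) (auto simp: complete_edges_def)
  finally show ?thesis
    by (simp add: algebra_simps)
qed

text \<open>The shift \<open>b\<close> is the limit of the planted excess (1-p)cn/2 over the
  standard deviation, which is asymptotically n sqrt(p(1-p)/2). The scaled argument
  \<open>u n\<close> is of order 1/n, so the fluctuation and the replaced factors vanish in the
  limit.\<close>

lemma planted_matching_char_tendsto:
  fixes p \<zeta> c t :: real
  assumes p: "0 < p" "p < 1" and c: "\<zeta> > 0" "0 < c" "c < 1" "\<zeta> * c = (1 - c)\<^sup>2"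
  defines "b \<equiv> c / sqrt 2 * sqrt ((1 - p) / p)"
  shows "(\<lambda>n. measure_pmf.expectation (planted_matching n p (1 / (\<zeta> * real n)))
            (\<lambda>A. iexp (t * (centered_edge_count n p A / sqrt (real (n choose 2) * p * (1 - p)) - b))))
         \<longlonglongrightarrow> complex_of_real (exp (- (t\<^sup>2) / 2))"
proof -
  define v where "v = sqrt (p * (1 - p))"
  have v: "v > 0"
    using p by (simp add: v_def)
  \<comment> \<open>The square root of \<open>n choose 2\<close> as an explicit real function, so
    that its asymptotics can be computed.\<close>
  define R where "R = (\<lambda>n. sqrt (real n * (real n - 1) / 2))"
  define u where "u = (\<lambda>n. t / sqrt (real (n choose 2) * p * (1 - p)))"
  have u: "u n = t / v * (1 / R n)" for n
    by (simp add: u_def v_def R_def of_nat_choose_two real_sqrt_mult real_sqrt_divide)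
  define \<epsilon> where "\<epsilon> = (\<lambda>n. (1 + 1 / \<zeta>) * (\<bar>u n\<bar> * sqrt n)
    + \<bar>u n * ((1 - p) * (c * n / 2)) - t * b\<bar> + real n * (u n)\<^sup>2)"
  have "(\<lambda>n. sqrt (real n) * (1 / R n)) \<longlonglongrightarrow> 0"
    unfolding R_def by real_asymp
  from tendsto_mult_right_zero[OF tendsto_rabs_zero[OF this], of "\<bar>t / v\<bar>"]
  have lim1: "(\<lambda>n. \<bar>u n\<bar> * sqrt n) \<longlonglongrightarrow> 0"
    by (simp add: u abs_mult algebra_simps)
  have "(\<lambda>n. real n * (1 / R n)\<^sup>2) \<longlonglongrightarrow> 0"
    unfolding R_def by real_asymp
  from tendsto_mult_right_zero[OF this, of "(t / v)\<^sup>2"]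
  have lim2: "(\<lambda>n. real n * (u n)\<^sup>2) \<longlonglongrightarrow> 0"
    by (simp only: u power_mult_distrib mult.left_commute)
  have "(\<lambda>n. real n * (1 / R n)) \<longlonglongrightarrow> sqrt 2"
    unfolding R_def by real_asymp (simp add: powr_half_sqrt real_sqrt_divide)
  from tendsto_mult_left[OF this, of "t / v * ((1 - p) * (c / 2))"]
  have "(\<lambda>n. u n * ((1 - p) * (c * n / 2))) \<longlonglongrightarrow> t / v * ((1 - p) * (c / 2)) * sqrt 2"
    by (simp add: u algebra_simps)
  also have "t / v * ((1 - p) * (c / 2)) * sqrt 2 = t * b"
  proof -
    have "(1 - p) / p * (p * (1 - p)) = (1 - p)\<^sup>2"
      using p by (simp add: power2_eq_square)
    then have "sqrt ((1 - p) / p) * v = 1 - p"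
      using p by (simp add: v_def flip: real_sqrt_mult)
    then have "(1 - p) / v = sqrt ((1 - p) / p)"
      using v by (simp add: field_simps)
    moreover have "c / 2 * sqrt 2 = c / sqrt 2"
      by (simp add: field_simps)
    moreover have "t / v * ((1 - p) * (c / 2)) * sqrt 2 = t * ((c / 2 * sqrt 2) * ((1 - p) / v))"
      by (simp add: mult_ac)
    ultimately show ?thesis
      by (simp only: b_def)
  qed
  finally have "(\<lambda>n. u n * ((1 - p) * (c * n / 2)) - t * b) \<longlonglongrightarrow> 0"
    by (simp add: LIM_zero)
  then have "\<epsilon> \<longlonglongrightarrow> (1 + 1 / \<zeta>) * 0 + \<bar>0\<bar> + 0"
    unfolding \<epsilon>_def by (intro tendsto_intros lim1 lim2)
  then have \<epsilon>: "\<epsilon> \<longlonglongrightarrow> 0"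
    by simp
  have expectation: "measure_pmf.expectation P
        (\<lambda>A. iexp (t * (centered_edge_count n p A / sqrt (real (n choose 2) * p * (1 - p)) - b)))
      = iexp (- (t * b)) * measure_pmf.expectation P (\<lambda>A. iexp (u n * centered_edge_count n p A))" for P n
    by (simp add: u_def algebra_simps exp_diff exp_minus divide_inverse)
  have "\<forall>\<^sub>F n in sequentially. cmod (measure_pmf.expectation (planted_matching n p (1 / (\<zeta> * real n)))
        (\<lambda>A. iexp (t * (centered_edge_count n p A / sqrt (real (n choose 2) * p * (1 - p)) - b)))
      - bernoulli_char p (u n) ^ (n choose 2)) \<le> \<epsilon> n"
    unfolding expectation \<epsilon>_def using eventually_gt_at_top[of 0]
    by eventually_elim (rule planted_matching_char_bound[OF p c])
  from Lim_null_comparison[OF this \<epsilon>]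
  have null: "(\<lambda>n. measure_pmf.expectation (planted_matching n p (1 / (\<zeta> * real n)))
        (\<lambda>A. iexp (t * (centered_edge_count n p A / sqrt (real (n choose 2) * p * (1 - p)) - b)))
      - bernoulli_char p (u n) ^ (n choose 2)) \<longlonglongrightarrow> 0" .
  \<comment> \<open>This power is the characteristic function under the null model, to which the
    shifted planted one has been compared.\<close>
  have "(\<lambda>n. bernoulli_char p (u n) ^ (n choose 2)) \<longlonglongrightarrow> complex_of_real (exp (- (t\<^sup>2) / 2))"
    unfolding u_def by (rule filterlim_compose[OF bernoulli_char_power_tendsto[OF p] filterlim_choose_two])
  from Lim_transform[OF this null] show ?thesis .
qed

section \<open>Error probabilities of the threshold test\<close>

theorem theorem2p6:
  fixes p q \<zeta> c :: real and lam :: "nat \<Rightarrow> real"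
  assumes "p = q" and "0 < p" and "p < 1"
    and "\<zeta> \<ge> 40"
    and "\<And>n. lam n = 1 / (\<zeta> * real n)"
    and "c = 1 - 1 / 2 * (sqrt (\<zeta>\<^sup>2 + 4 * \<zeta>) - \<zeta>)"
  shows "(\<lambda>n. measure_pmf.prob (planted_matching n p (lam n)) {A. threshold_test p q c n A = 0}
            + measure_pmf.prob (erdos_renyi n q) {A. threshold_test p q c n A = 1})
         \<longlonglongrightarrow> 2 * std_normal_cdf (- (c / (2 * sqrt 2) * sqrt ((1 - p) / p)))"
proof -
  define \<tau> where "\<tau> = c / (2 * sqrt 2) * sqrt ((1 - p) / p)"
  define X where "X = (\<lambda>n A. centered_edge_count n p A / sqrt (real (n choose 2) * p * (1 - p)))"
  have \<zeta>: "\<zeta> > 0"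
    using assms(4) by simp
  have c: "0 < c" "c < 1"
    using matching_constant_bounds[OF \<zeta>] assms(6) by auto
  \<comment> \<open>Squaring S = \<zeta> + 2(1-c) gives the balance equation for
    \<open>c\<close>.\<close>
  define S where "S = sqrt (\<zeta>\<^sup>2 + 4 * \<zeta>)"
  have "S\<^sup>2 = \<zeta>\<^sup>2 + 4 * \<zeta>"
    unfolding S_def using \<zeta> by (intro real_sqrt_pow2) simp
  moreover have "S = \<zeta> + 2 * (1 - c)"
    using assms(6) unfolding S_def[symmetric] by (simp add: field_simps)
  ultimately have balance: "\<zeta> * c = (1 - c)\<^sup>2"
    by (simp add: power2_eq_square algebra_simps)
  \<comment> \<open>The threshold lies midway between the limit means 0 and 2 \<tau>, so both errors
    tend to the same tail.\<close>
  have shift: "c / sqrt 2 * sqrt ((1 - p) / p) = 2 * \<tau>"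
    by (simp add: \<tau>_def)
  have "(\<lambda>n. measure_pmf.prob (planted_matching n p (1 / (\<zeta> * real n))) {A. X n A - 2 * \<tau> < - \<tau>})
      \<longlonglongrightarrow> std_normal_cdf (- \<tau>)"
    using planted_matching_char_tendsto[OF assms(2,3) \<zeta> c balance]
    unfolding X_def shift by (intro pmf_levy_prob_less)
  moreover have "{A. X n A - 2 * \<tau> < - \<tau>} = {A. threshold_test p q c n A = 0}" for n
    by (auto simp: threshold_test_def X_def \<tau>_def assms(1))
  moreover have "(\<lambda>n. measure_pmf.prob (erdos_renyi n q) {A. X n A \<ge> \<tau>}) \<longlonglongrightarrow> std_normal_cdf (- \<tau>)"
    using erdos_renyi_char_tendsto[OF assms(2,3)]
    unfolding X_def assms(1)[symmetric] by (intro pmf_levy_prob_ge)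
  moreover have "{A. X n A \<ge> \<tau>} = {A. threshold_test p q c n A = 1}" for n
    by (auto simp: threshold_test_def X_def \<tau>_def assms(1))
  ultimately have "(\<lambda>n. measure_pmf.prob (planted_matching n p (lam n)) {A. threshold_test p q c n A = 0}
            + measure_pmf.prob (erdos_renyi n q) {A. threshold_test p q c n A = 1})
         \<longlonglongrightarrow> std_normal_cdf (- \<tau>) + std_normal_cdf (- \<tau>)"
    by (intro tendsto_add) (simp_all add: assms(5))
  then show ?thesis
    by (simp add: \<tau>_def)
qed

end
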